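(* Let $d=2^t$ be a power of two. Let $m$ be a positive integer, and let $X = \{x_1, \dots, x_m\} \subset \mathbb{R}^{2d-2}$ be a set of $m$ points. Let $A_1, \dots, A_m \subset S^d \times S^{d-1}$ be closed sets such that $A_i \cap g_1\cdot A_i = \emptyset$ and $A_i \cap g_2 \cdot A_i = \emptyset$ for all $i \in [m]$, and $\bigcup_i G\cdot A_i = S^d \times S^{d-1}$. Then there are disjoint subsets $S, T \subset [m]$ and functions $\alpha\colon S \to \{g_1, g_2\}$ and $\beta \colon T\to \{1, g_1g_2\}$ such that \[\operatorname{conv}\{x_i \mid i \in S\} \cap \operatorname{conv}\{x_i \mid i \in T\} \neq \emptyset \quad\text{and}\quad \bigcap_{i \in S} (\alpha(i)\cdot A_i) \cap \bigcap_{i \in T} (\beta(i)\cdot A_i) \neq \emptyset.\]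
   Context: $(\mathbb{Z}/2)^2$ with generators $g_1,g_2$ (identity $1$) acts on $S^d\times S^{d-1}$ by $g_1\cdot(x,y)=(-x,y)$ and $g_2\cdot(x,y)=(x,-y)$. For $A\subset S^d\times S^{d-1}$, $g\cdot A=\{g\cdot p \mid p\in A\}$ and $G\cdot A = A\cup g_1\cdot A\cup g_2\cdot A\cup g_1g_2\cdot A$. *)

theory Defs
  imports "HOL-Analysis.Analysis" "HOL-Library.Z2"
begin

text \<open>
  The group \<open>(\<int>/2)\<^sup>2\<close> is the additive group of \<^typ>\<open>bit \<times> bit\<close>: the identity of the group is
  \<open>0\<close> and the product \<open>g\<^sub>1 g\<^sub>2\<close> is written \<open>g1 + g2\<close>.
\<close>

type_synonym klein = "bit \<times> bit"

definition g1 :: klein where "g1 = (1, 0)"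

definition g2 :: klein where "g2 = (0, 1)"

text \<open>
  Points of \<open>\<real>\<^sup>n\<close> are sequences that vanish from index \<open>n\<close> on, as in \<^const>\<open>Euclidean_space\<close> and
  \<^const>\<open>nsphere\<close>. This includes \<open>\<real>\<^sup>0\<close>, which no Euclidean space type represents.
\<close>

definition act :: "klein \<Rightarrow> (nat \<Rightarrow> real) \<times> (nat \<Rightarrow> real) \<Rightarrow> (nat \<Rightarrow> real) \<times> (nat \<Rightarrow> real)" where
  "act g p =
    ((if fst g = 1 then (\<lambda>k. - fst p k) else fst p),
     (if snd g = 1 then (\<lambda>k. - snd p k) else snd p))"

lemma act_g1: "act g1 (x, y) = ((\<lambda>k. - x k), y)"
  by (simp add: act_def g1_def)

lemma act_g2: "act g2 (x, y) = (x, (\<lambda>k. - y k))"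
  by (simp add: act_def g2_def)

lemma act_zero: "act 0 p = p"
  by (simp add: act_def)

lemma act_add: "act (g + h) p = act g (act h p)"
  by (cases "fst g"; cases "snd g"; cases "fst h"; cases "snd h") (simp_all add: act_def)

lemma act_sphere_product:
  assumes "p \<in> topspace (prod_topology (nsphere m) (nsphere n))"
  shows "act g p \<in> topspace (prod_topology (nsphere m) (nsphere n))"
  using assms by (auto simp: act_def nsphere)

definition G_orbit :: "((nat \<Rightarrow> real) \<times> (nat \<Rightarrow> real)) set \<Rightarrow> ((nat \<Rightarrow> real) \<times> (nat \<Rightarrow> real)) set" where
  "G_orbit A = A \<union> act g1 ` A \<union> act g2 ` A \<union> act (g1 + g2) ` A"

text \<open>
  The type \<^typ>\<open>nat \<Rightarrow> real\<close> is not an instance of \<^class>\<open>real_vector\<close>, so \<^const>\<open>convex\<close> is restated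
  for it with pointwise operations.
\<close>

definition seq_convex :: "(nat \<Rightarrow> real) set \<Rightarrow> bool" where
  "seq_convex C \<longleftrightarrow>
    (\<forall>x\<in>C. \<forall>y\<in>C. \<forall>u\<ge>0. \<forall>v\<ge>0. u + v = 1 \<longrightarrow> (\<lambda>k. u * x k + v * y k) \<in> C)"

end

theory Submission
  imports Defs "HOL-Homology.Simplices"
begin

text \<open>
  The core is a Borsuk--Ulam theorem: if \<open>(m + n) choose m\<close> is odd, then a map
  \<open>S\<^sup>m \<times> S\<^sup>n \<rightarrow> \<real>\<^bsup>m+n\<^esup>\<close> that changes sign under both \<open>g\<^sub>1\<close> and \<open>g\<^sub>2\<close> has a zero. The products of
  hemispheres carry singular chains \<open>c\<^sub>i\<^sub>j\<close> whose boundary is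
  \<open>(1 \<plusminus> g\<^sub>1) c\<^bsub>i-1,j\<^esub> \<plusminus> (1 \<plusminus> g\<^sub>2) c\<^bsub>i,j-1\<^esub>\<close>. If there is no zero, the signs of the coordinates define
  mod 2 functions \<open>\<epsilon>\<^sub>k\<close> on points that flip under \<open>g\<^sub>1\<close> and \<open>g\<^sub>2\<close>. The product of their coboundaries is
  a cocycle whose value on \<open>c\<^sub>i\<^sub>j\<close> satisfies Pascal's recursion, so that it is
  \<open>(m + n) choose m\<close>, also after barycentric subdivision. On a fine subdivision some coordinate has
  constant sign on each simplex, so that the value is \<open>0\<close>.

  For the theorem put \<open>P\<^sub>i = A\<^sub>i \<union> g\<^sub>1g\<^sub>2A\<^sub>i\<close> and \<open>N\<^sub>i = g\<^sub>1A\<^sub>i \<union> g\<^sub>2A\<^sub>i\<close>, and let \<open>\<phi>\<^sub>i\<close> be a function that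
  is positive only near \<open>P\<^sub>i\<close>, negative only near \<open>N\<^sub>i\<close>, and odd under \<open>g\<^sub>1\<close> and \<open>g\<^sub>2\<close>. A common zero of
  \<open>\<Sum> \<phi>\<^sub>i x\<^sub>i\<close> and \<open>\<Sum> \<phi>\<^sub>i\<close> exists because \<open>(2d - 1) choose d\<close> is odd; it is an affine dependence that
  makes the two convex hulls meet. Shrinking the neighbourhoods and passing to a limit finishes.
\<close>

section \<open>Evaluating cochains on singular chains\<close>

text \<open>Singular chains have integer coefficients, cochains any commutative ring. With
  \<open>bit\<close> as that ring all signs of boundary formulas disappear.\<close>

definition cochain_eval :: "('s \<Rightarrow> 'r::comm_ring_1) \<Rightarrow> ('s \<Rightarrow>\<^sub>0 int) \<Rightarrow> 'r" where
  "cochain_eval w c = (\<Sum>s\<in>Poly_Mapping.keys c. of_int (Poly_Mapping.lookup c s) * w s)"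

lemma cochain_eval_superset:
  assumes "finite S" "Poly_Mapping.keys c \<subseteq> S"
  shows "cochain_eval w c = (\<Sum>s\<in>S. of_int (Poly_Mapping.lookup c s) * w s)"
  unfolding cochain_eval_def
  by (rule sum.mono_neutral_left) (use assms in \<open>auto simp: in_keys_iff\<close>)

lemma cochain_eval_0 [simp]: "cochain_eval w 0 = 0"
  by (simp add: cochain_eval_def)

lemma cochain_eval_of [simp]: "cochain_eval w (frag_of s) = w s"
  by (simp add: cochain_eval_def)

lemma cochain_eval_add: "cochain_eval w (a + b) = cochain_eval w a + cochain_eval w b"
proof -
  let ?S = "Poly_Mapping.keys a \<union> Poly_Mapping.keys b"
  have "Poly_Mapping.keys (a + b) \<subseteq> ?S"
    by (rule Poly_Mapping.keys_add)
  then show ?thesis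
    by (simp add: cochain_eval_superset [of ?S] lookup_add distrib_right sum.distrib)
qed

lemma cochain_eval_cmul: "cochain_eval w (frag_cmul n c) = of_int n * cochain_eval w c"
proof -
  have "Poly_Mapping.keys (frag_cmul n c) \<subseteq> Poly_Mapping.keys c"
    by (rule keys_cmul)
  then have "cochain_eval w (frag_cmul n c)
      = (\<Sum>s\<in>Poly_Mapping.keys c. of_int (Poly_Mapping.lookup (frag_cmul n c) s) * w s)"
    by (intro cochain_eval_superset) auto
  then show ?thesis
    by (simp add: cochain_eval_def sum_distrib_left mult.assoc)
qed

lemma cochain_eval_diff: "cochain_eval w (a - b) = cochain_eval w a - cochain_eval w b"
  using cochain_eval_add [of w a "frag_cmul (-1) b"] cochain_eval_cmul [of w "-1" b] by simp

lemma cochain_eval_sum: "cochain_eval w (sum f I) = (\<Sum>i\<in>I. cochain_eval w (f i))"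
  by (induction I rule: infinite_finite_induct) (simp_all add: cochain_eval_add)

lemma cochain_eval_frag_extend:
  "cochain_eval w (frag_extend f c) = cochain_eval (\<lambda>s. cochain_eval w (f s)) c"
  using subset_UNIV
  by (induction c rule: frag_induction) (auto simp: frag_extend_diff cochain_eval_diff)

lemma cochain_eval_cong:
  "(\<And>s. s \<in> Poly_Mapping.keys c \<Longrightarrow> w s = w' s) \<Longrightarrow> cochain_eval w c = cochain_eval w' c"
  by (simp add: cochain_eval_def)

lemma cochain_eval_fun_add:
  "cochain_eval (\<lambda>s. w s + w' s) c = cochain_eval w c + cochain_eval w' c"
  by (simp add: cochain_eval_def distrib_left sum.distrib)

section \<open>The mod 2 cocycle of sign changes\<close>

definition simplex_vertices :: "((nat \<Rightarrow> real) \<Rightarrow> 'a) \<Rightarrow> nat \<Rightarrow> 'a" where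
  "simplex_vertices s i = s (\<lambda>j. if j = i then 1 else 0)"

definition omit :: "nat \<Rightarrow> (nat \<Rightarrow> 'a) \<Rightarrow> nat \<Rightarrow> 'a" where
  "omit k v i = v (if i < k then i else Suc i)"

lemma simplex_vertices_face:
  assumes "i \<le> p"
  shows "simplex_vertices (singular_face (Suc p) k s) i = omit k (simplex_vertices s) i"
proof -
  have "simplical_face k (\<lambda>j. if j = i then 1 else 0 :: real) =
        (\<lambda>j. if j = (if i < k then i else Suc i) then 1 else 0)"
    by (auto simp: simplical_face_def fun_eq_iff)
  then show ?thesis
    using assms by (simp add: simplex_vertices_def omit_def singular_face_def)
qed

lemma simplex_vertices_map:
  "i \<le> p \<Longrightarrow> simplex_vertices (simplex_map p f s) i = f (simplex_vertices s i)"
  by (simp add: simplex_vertices_def simplex_map_def)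

lemma simplex_vertices_in:
  assumes "singular_simplex p X s" "i \<le> p"
  shows "simplex_vertices s i \<in> topspace X"
proof -
  have "s \<in> standard_simplex p \<rightarrow> topspace X"
    using assms(1) by (auto simp: singular_simplex_def continuous_map_def)
  then show ?thesis
    using assms(2) by (auto simp: simplex_vertices_def)
qed

text \<open>The cup product \<open>\<delta>e\<^bsub>k-1\<^esub> \<union> \<dots> \<union> \<delta>e\<^sub>0\<close>, as a function of the vertices of a simplex.\<close>

primrec sign_cocycle :: "(nat \<Rightarrow> 'a \<Rightarrow> bit) \<Rightarrow> nat \<Rightarrow> (nat \<Rightarrow> 'a) \<Rightarrow> bit" where
  "sign_cocycle e 0 v = 1"
| "sign_cocycle e (Suc k) v = (e k (v 0) + e k (v 1)) * sign_cocycle e k (v \<circ> Suc)"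

lemma sign_cocycle_cong:
  "(\<And>i. i \<le> k \<Longrightarrow> v i = w i) \<Longrightarrow> sign_cocycle e k v = sign_cocycle e k w"
proof (induction k arbitrary: v w)
  case (Suc k)
  have "sign_cocycle e k (v \<circ> Suc) = sign_cocycle e k (w \<circ> Suc)"
    by (rule Suc.IH) (simp add: Suc.prems)
  then show ?case
    by (simp add: Suc.prems)
qed simp

text \<open>The factor that belongs to \<open>e k\<close> is \<open>z + z\<close>, which is
  \<open>0\<close> mod 2.\<close>

lemma sign_cocycle_eq_0:
  "\<lbrakk>k < n; \<And>i. i \<le> n \<Longrightarrow> e k (v i) = z\<rbrakk> \<Longrightarrow> sign_cocycle e n v = 0"
proof (induction n arbitrary: v)
  case (Suc n)
  show ?case
  proof (cases "k = n")
    case True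
    then show ?thesis
      using Suc.prems(2)[of 0] Suc.prems(2)[of 1] by simp
  next
    case False
    then have "sign_cocycle e n (v \<circ> Suc) = 0"
      by (intro Suc.IH) (use Suc.prems in auto)
    then show ?thesis by simp
  qed
qed simp

text \<open>Only differences of values of \<open>e\<close> enter the product, so a simultaneous flip
  at all vertices cancels.\<close>

lemma sign_cocycle_flip:
  assumes "\<And>i k. i \<le> n \<Longrightarrow> e k (w i) = e k (v i) + 1"
  shows "sign_cocycle e n w = sign_cocycle e n v"
  using assms
proof (induction n arbitrary: v w)
  case (Suc n)
  have "sign_cocycle e n (w \<circ> Suc) = sign_cocycle e n (v \<circ> Suc)"
    by (rule Suc.IH) (simp add: Suc.prems)
  moreover have "e n (w 0) + e n (w 1) = e n (v 0) + e n (v 1)"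
    using Suc.prems[of 0 n] Suc.prems[of 1 n] by (cases "e n (v 0)"; cases "e n (v 1)") simp_all
  ultimately show ?case by simp
qed simp

lemma bit_minus_one_power: "(- 1 :: bit) ^ n = 1"
  by simp

lemma bit_add_eq_0_iff: "a + b = 0 \<longleftrightarrow> b = a" for a b :: bit
  by (cases a; cases b) simp_all

lemma omit_0: "omit 0 v = v \<circ> Suc"
  by (auto simp: omit_def)

lemma omit_Suc_comp: "omit (Suc k) v \<circ> Suc = omit k (v \<circ> Suc)"
  by (auto simp: omit_def)

text \<open>The cocycle condition. Only faces \<open>0\<close> and \<open>1\<close> change the first
  edge; the others keep it and are handled by induction on the tail. The three first-edge
  coefficients cancel mod 2.\<close>

lemma sum_sign_cocycle_omit: "(\<Sum>k\<le>Suc n. sign_cocycle e n (omit k v)) = 0"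
proof (induction n arbitrary: v)
  case 0
  then show ?case by simp
next
  case (Suc n)
  let ?C = "sign_cocycle e n (v \<circ> Suc \<circ> Suc)"
  \<comment> \<open>Mod 2 a vanishing sum says that its first term, here face \<open>0\<close> of
    the tail, equals the sum of the rest.\<close>
  have IH: "(\<Sum>k\<le>n. sign_cocycle e n (omit (Suc k) (v \<circ> Suc))) = ?C"
    using Suc.IH[of "v \<circ> Suc"]
    unfolding sum.atMost_Suc_shift omit_0 bit_add_eq_0_iff .
  have "(\<Sum>k\<le>Suc (Suc n). sign_cocycle e (Suc n) (omit k v))
      = (e n (v 1) + e n (v 2)) * ?C + ((e n (v 0) + e n (v 2)) * ?C
        + (\<Sum>k\<le>n. (e n (v 0) + e n (v 1)) * sign_cocycle e n (omit (Suc k) (v \<circ> Suc))))"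
  proof -
    have "omit 0 v 0 = v 1" "omit 0 v 1 = v 2" "omit (Suc 0) v 0 = v 0" "omit (Suc 0) v 1 = v 2"
      "\<And>k. omit (Suc (Suc k)) v 0 = v 0" "\<And>k. omit (Suc (Suc k)) v 1 = v 1"
      by (simp_all add: omit_def numeral_2_eq_2)
    then show ?thesis
      by (simp only: sum.atMost_Suc_shift sign_cocycle.simps omit_Suc_comp omit_0 comp_assoc)
  qed
  also have "\<dots> = 0"
    unfolding sum_distrib_left [symmetric] IH
    by (cases "e n (v 0)"; cases "e n (v 1)"; cases "e n (v 2)"; cases ?C) simp_all
  finally show ?case .
qed

text \<open>A primitive of the next cocycle: face \<open>0\<close> starts at \<open>v 1\<close>, all
  other faces start at \<open>v 0\<close>, and by the cocycle condition these sum to the value on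
  face \<open>0\<close>.\<close>

lemma sum_sign_cochain_omit:
  "(\<Sum>k\<le>Suc n. e n (omit k v 0) * sign_cocycle e n (omit k v)) = sign_cocycle e (Suc n) v"
proof -
  have "(\<Sum>k\<le>n. sign_cocycle e n (omit (Suc k) v)) = sign_cocycle e n (v \<circ> Suc)"
    using sum_sign_cocycle_omit[of e n v]
    unfolding sum.atMost_Suc_shift omit_0 bit_add_eq_0_iff .
  then have "(\<Sum>k\<le>n. e n (v 0) * sign_cocycle e n (omit (Suc k) v))
      = e n (v 0) * sign_cocycle e n (v \<circ> Suc)"
    by (simp only: flip: sum_distrib_left)
  moreover have "omit 0 v 0 = v 1" "\<And>k. omit (Suc k) v 0 = v 0"
    by (simp_all add: omit_def)
  ultimately show ?thesis
    by (simp only: sum.atMost_Suc_shift omit_0 sign_cocycle.simps distrib_right add.commute)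
qed

definition eval_sign_cocycle :: "(nat \<Rightarrow> 'a \<Rightarrow> bit) \<Rightarrow> nat \<Rightarrow> 'a chain \<Rightarrow> bit" where
  "eval_sign_cocycle e n = cochain_eval (\<lambda>s. sign_cocycle e n (simplex_vertices s))"

text \<open>The cup product of \<open>e n\<close> with the cocycle. Unlike the cocycle it is not
  invariant under flips, and its defect is the cocycle itself.\<close>

definition eval_sign_cochain :: "(nat \<Rightarrow> 'a \<Rightarrow> bit) \<Rightarrow> nat \<Rightarrow> 'a chain \<Rightarrow> bit" where
  "eval_sign_cochain e n =
     cochain_eval (\<lambda>s. e n (simplex_vertices s 0) * sign_cocycle e n (simplex_vertices s))"

text \<open>Stokes' formula mod 2, from \<open>sum_sign_cochain_omit\<close> applied to each
  simplex.\<close>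

lemma eval_sign_cochain_boundary:
  "eval_sign_cochain e n (chain_boundary (Suc n) c) = eval_sign_cocycle e (Suc n) c"
proof -
  have face: "sign_cocycle e n (simplex_vertices (singular_face (Suc n) k s))
      = sign_cocycle e n (omit k (simplex_vertices s))" for k s
    by (rule sign_cocycle_cong) (rule simplex_vertices_face)
  show ?thesis
    unfolding eval_sign_cochain_def eval_sign_cocycle_def chain_boundary_def
    by (simp only: cochain_eval_frag_extend cochain_eval_sum cochain_eval_cmul cochain_eval_of face
        simplex_vertices_face [OF le0] of_int_power of_int_minus of_int_1 bit_minus_one_power
        mult_1 sum_sign_cochain_omit nat.distinct if_False)
qed

text \<open>The group ring element \<open>1 + (-1)\<^sup>n g\<close> applied to a \<open>p\<close>-chain.\<close>

definition twist :: "nat \<Rightarrow> ('a \<Rightarrow> 'a) \<Rightarrow> nat \<Rightarrow> 'a chain \<Rightarrow> 'a chain" where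
  "twist p g n c = c + frag_cmul ((-1) ^ n) (chain_map p g c)"

text \<open>Under \<open>g\<close> the factor \<open>e p\<close> becomes \<open>e p + 1\<close>
  while the cocycle is unchanged, so a chain and its image together leave exactly one copy of the
  cocycle. The sign in \<open>twist\<close> is invisible mod 2.\<close>

lemma eval_sign_cochain_twist:
  assumes c: "singular_chain p (subtopology X S) c"
    and e: "\<And>k x. x \<in> S \<Longrightarrow> e k (g x) = e k x + 1"
  shows "eval_sign_cochain e p (twist p g n c) = eval_sign_cocycle e p c"
proof -
  let ?v = simplex_vertices
  have "eval_sign_cochain e p (chain_map p g c)
      = cochain_eval (\<lambda>s. (e p (?v s 0) + 1) * sign_cocycle e p (?v s)) c"
    unfolding eval_sign_cochain_def chain_map_def cochain_eval_frag_extend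
  proof (rule cochain_eval_cong)
    fix s assume "s \<in> Poly_Mapping.keys c"
    then have s: "singular_simplex p (subtopology X S) s"
      using c by (auto simp: singular_chain_def)
    have *: "e k (?v (simplex_map p g s) i) = e k (?v s i) + 1" if "i \<le> p" for i k
      using that e simplex_vertices_in [OF s that] by (simp add: simplex_vertices_map)
    have "sign_cocycle e p (?v (simplex_map p g s)) = sign_cocycle e p (?v s)"
      by (rule sign_cocycle_flip) (rule *)
    then show "cochain_eval (\<lambda>s. e p (?v s 0) * sign_cocycle e p (?v s)) ((frag_of \<circ> simplex_map p g) s)
        = (e p (?v s 0) + 1) * sign_cocycle e p (?v s)"
      by (simp add: *)
  qed
  also have "\<dots> = eval_sign_cochain e p c + eval_sign_cocycle e p c"
    unfolding eval_sign_cochain_def eval_sign_cocycle_def distrib_right mult_1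
    by (rule cochain_eval_fun_add)
  finally have "eval_sign_cochain e p (chain_map p g c)
      = eval_sign_cochain e p c + eval_sign_cocycle e p c" .
  then have "eval_sign_cochain e p (twist p g n c)
      = eval_sign_cochain e p c + (eval_sign_cochain e p c + eval_sign_cocycle e p c)"
    unfolding twist_def eval_sign_cochain_def
    by (simp only: cochain_eval_add cochain_eval_cmul of_int_power of_int_minus of_int_1
        bit_minus_one_power mult_1)
  then show ?thesis
    by (cases "eval_sign_cochain e p c"; cases "eval_sign_cocycle e p c") simp_all
qed

section \<open>Chains on the cells of a space with two involutions\<close>

text \<open>A contraction makes \<open>c\<close> homologous to its image in a point. In positive
  degree that image is a boundary; in degree \<open>0\<close> it vanishes by \<open>aug\<close>,
  which says that the augmentation of \<open>c\<close> is zero.\<close>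

lemma contractible_cycle_is_boundary:
  fixes X :: "'a topology"
  assumes X: "contractible_space X" "topspace X \<noteq> {}"
    and c: "singular_chain p X c" "chain_boundary p c = 0"
    and aug: "\<And>a::'a. p = 0 \<Longrightarrow> chain_map 0 (\<lambda>_. a) c = 0"
  shows "\<exists>d. singular_chain (Suc p) X d \<and> chain_boundary (Suc p) d = c"
proof -
  obtain a where a: "homotopic_with (\<lambda>_. True) X X id (\<lambda>_. a)"
    using X by (auto simp: contractible_space_def)
  have aX: "a \<in> topspace X"
    using homotopic_with_imp_continuous_maps [OF a] X(2) by (auto simp: continuous_map_def)
  have cyc: "singular_relcycle p X {} c"
    using c by (simp add: singular_cycle)
  have "homologous_rel p X {} (chain_map p id c) (chain_map p (\<lambda>_. a) c)"
    by (rule homotopic_imp_homologous_rel_chain_maps [OF _ cyc]) (use a in simp)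
  moreover have "chain_map p id c = c"
    using c by (intro chain_map_id_gen [of p X]) auto
  ultimately have 1: "singular_relboundary p X {} (c - chain_map p (\<lambda>_. a) c)"
    by (simp add: homologous_rel_def)
  have "singular_relboundary p X {} (chain_map p (\<lambda>_. a) c)"
  proof (cases "p = 0")
    case True
    then show ?thesis using aug by simp
  next
    case False
    have "singular_relcycle p (subtopology X {a}) {} (chain_map p (\<lambda>_. a) c)"
      by (rule singular_relcycle_chain_map [OF cyc]) (use aX in \<open>auto simp: continuous_map_in_subtopology\<close>)
    then have "singular_relboundary p (subtopology X {a}) {} (chain_map p (\<lambda>_. a) c)"
      using False aX by (subst singular_boundary_eq_cycle_singleton [of _ a]) auto
    then have "singular_relboundary p (subtopology X (topspace X)) {} (chain_map p (\<lambda>_. a) c)"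
      by (rule singular_boundary_mono [rotated]) (use aX in auto)
    then show ?thesis by simp
  qed
  then have "singular_relboundary p X {} (c - chain_map p (\<lambda>_. a) c + chain_map p (\<lambda>_. a) c)"
    by (rule singular_relboundary_add [OF 1])
  then show ?thesis
    by (simp add: singular_boundary)
qed

section \<open>The algebra of twisted chains and chains fitted to cells\<close>

lemma twist_0 [simp]: "twist p g n 0 = 0"
  by (simp add: twist_def)

lemma twist_add: "twist p g n (a + b) = twist p g n a + twist p g n b"
  by (simp add: twist_def chain_map_add frag_cmul_distrib2)

lemma twist_cmul: "twist p g n (frag_cmul k c) = frag_cmul k (twist p g n c)"
  by (simp add: twist_def frag_cmul_distrib2 mult.commute)

lemma singular_chain_twist:
  assumes "singular_chain p (subtopology X S) c" "continuous_map X X g" "S \<subseteq> T" "g ` S \<subseteq> T"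
  shows "singular_chain p (subtopology X T) (twist p g n c)"
  unfolding twist_def
proof (intro singular_chain_add singular_chain_cmul)
  show "singular_chain p (subtopology X T) c"
    using assms singular_chain_mono by blast
  have "continuous_map (subtopology X S) (subtopology X T) g"
    using assms by (auto simp: continuous_map_in_subtopology continuous_map_from_subtopology)
  then show "singular_chain p (subtopology X T) (chain_map p g c)"
    using assms(1) singular_chain_chain_map by blast
qed

lemma chain_boundary_twist:
  assumes "singular_chain (Suc p) X c"
  shows "chain_boundary (Suc p) (twist (Suc p) g n c) = twist p g n (chain_boundary (Suc p) c)"
  using chain_boundary_chain_map [OF assms, of g]
  by (simp add: twist_def chain_boundary_add chain_boundary_cmul)

text \<open>Consecutive exponents have opposite signs, so the product is \<open>1 - g^2 = 0\<close>
  in the group ring.\<close>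

lemma twist_twist_Suc:
  assumes "singular_chain p X c" "\<And>x. x \<in> topspace X \<Longrightarrow> g (g x) = x"
  shows "twist p g (Suc n) (twist p g n c) = 0"
proof -
  have "chain_map p g (chain_map p g c) = chain_map p (g \<circ> g) c"
    by (simp add: chain_map_compose)
  also have "\<dots> = c"
    using assms by (intro chain_map_id_gen [of p X]) auto
  finally show ?thesis
    by (simp add: twist_def chain_map_add frag_cmul_distrib2 flip: frag_cmul_distrib)
qed

lemma twist_commute:
  assumes "singular_chain p X c" "\<And>x. x \<in> topspace X \<Longrightarrow> g (h x) = h (g x)"
  shows "twist p g m (twist p h n c) = twist p h n (twist p g m c)"
proof -
  have "chain_map p (g \<circ> h) c = chain_map p (h \<circ> g) c"
    using assms by (intro chain_map_eq [of p X]) auto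
  then have "chain_map p g (chain_map p h c) = chain_map p h (chain_map p g c)"
    by (simp add: chain_map_compose)
  then show ?thesis
    by (simp add: twist_def chain_map_add frag_cmul_distrib2 mult.commute add_ac)
qed

lemma singular_subdivision_twist:
  assumes "singular_chain p X c"
  shows "singular_subdivision p (twist p g n c) = twist p g n (singular_subdivision p c)"
  using naturality_singular_subdivision [OF assms, of g]
  by (simp add: twist_def singular_subdivision_def frag_extend_add frag_extend_cmul)

text \<open>The differential of the tensor product of the standard resolutions of two groups of
  order two, with the Koszul sign \<open>(-1) ^ i\<close>. The tests for \<open>0\<close> guard the
  truncated subtraction.\<close>

definition cell_boundary ::
    "('a \<Rightarrow> 'a) \<Rightarrow> ('a \<Rightarrow> 'a) \<Rightarrow> (nat \<Rightarrow> nat \<Rightarrow> 'a chain) \<Rightarrow> nat \<Rightarrow> nat \<Rightarrow> 'a chain" where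
  "cell_boundary g h c i j =
     (if i = 0 then 0 else twist (i + j - 1) g i (c (i - 1) j)) +
     (if j = 0 then 0 else frag_cmul ((-1) ^ i) (twist (i + j - 1) h j (c i (j - 1))))"

locale commuting_involutions =
  fixes X :: "'a topology" and g h :: "'a \<Rightarrow> 'a" and K :: "nat \<Rightarrow> nat \<Rightarrow> 'a set"
  assumes cont_g: "continuous_map X X g" and cont_h: "continuous_map X X h"
    and invol_g: "\<And>x. x \<in> topspace X \<Longrightarrow> g (g x) = x"
    and invol_h: "\<And>x. x \<in> topspace X \<Longrightarrow> h (h x) = x"
    and commute: "\<And>x. x \<in> topspace X \<Longrightarrow> g (h x) = h (g x)"
    and cell_left: "\<And>i j. K i j \<union> g ` K i j \<subseteq> K (Suc i) j"
    and cell_right: "\<And>i j. K i j \<union> h ` K i j \<subseteq> K i (Suc j)"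
begin

text \<open>An equivariant chain map from that tensor product, given on generators. Requiring a
  single simplex in degree \<open>0\<close> makes the cocycle start with value
  \<open>1\<close>.\<close>

definition cell_system :: "(nat \<Rightarrow> nat \<Rightarrow> 'a chain) \<Rightarrow> bool" where
  "cell_system c \<longleftrightarrow>
     (\<forall>i j. singular_chain (i + j) (subtopology X (K i j)) (c i j)) \<and>
     (\<exists>s. c 0 0 = frag_of s) \<and>
     (\<forall>i j. chain_boundary (i + j) (c i j) = cell_boundary g h c i j)"

lemma chain_in_X: "singular_chain p (subtopology X S) c \<Longrightarrow> singular_chain p X c"
  by (simp add: singular_chain_subtopology)

lemma singular_chain_cell_boundary:
  assumes "0 < i + j"
    and "0 < i \<Longrightarrow> singular_chain (i - 1 + j) (subtopology X (K (i - 1) j)) (c (i - 1) j)"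
    and "0 < j \<Longrightarrow> singular_chain (i + (j - 1)) (subtopology X (K i (j - 1))) (c i (j - 1))"
  shows "singular_chain (i + j - 1) (subtopology X (K i j)) (cell_boundary g h c i j)"
proof -
  have "singular_chain (i + j - 1) (subtopology X (K i j)) (twist (i + j - 1) g i (c (i - 1) j))"
    if "0 < i"
    using that assms(2) cell_left[of "i - 1" j] cont_g
    by (intro singular_chain_twist [where S = "K (i - 1) j"]) auto
  moreover have "singular_chain (i + j - 1) (subtopology X (K i j)) (twist (i + j - 1) h j (c i (j - 1)))"
    if "0 < j"
    using that assms(3) cell_right[of i "j - 1"] cont_h
    by (intro singular_chain_twist [where S = "K i (j - 1)"]) auto
  ultimately show ?thesis
    unfolding cell_boundary_def
    by (auto intro!: singular_chain_add singular_chain_cmul)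
qed

text \<open>Two twists in the same direction give zero by \<open>twist_twist_Suc\<close>; the two
  mixed terms agree because \<open>g\<close> and \<open>h\<close> commute, and cancel by the Koszul
  sign.\<close>

lemma chain_boundary_cell_boundary:
  assumes chain: "\<And>i' j'. i' + j' < i + j \<Longrightarrow> singular_chain (i' + j') X (c i' j')"
    and bd: "\<And>i' j'. i' + j' < i + j \<Longrightarrow> chain_boundary (i' + j') (c i' j') = cell_boundary g h c i' j'"
  shows "chain_boundary (i + j - 1) (cell_boundary g h c i j) = 0"
proof (cases "i + j \<le> 1")
  case True
  then show ?thesis by (simp add: chain_boundary_def)
next
  case False
  then obtain q where q: "i + j = Suc (Suc q)"
    by (metis Suc_le_eq add_2_eq_Suc less_iff_Suc_add not_le numeral_2_eq_2 One_nat_def add_Suc)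
  define L where "L = (if i = 0 then 0 else twist (Suc q) g i (c (i - 1) j))"
  define R where "R = (if j = 0 then 0 else twist (Suc q) h j (c i (j - 1)))"
  define D where "D = (if i = 0 \<or> j = 0 then 0 else twist q g i (twist q h j (c (i - 1) (j - 1))))"
  \<comment> \<open>The Koszul sign of the cell \<open>(i - 1, j)\<close> is
    \<open>(-1) ^ (i - 1)\<close>, which is the negative of \<open>(-1) ^ i\<close>.\<close>
  have "chain_boundary (Suc q) L = frag_cmul (- ((-1) ^ i)) D"
  proof (cases "i = 0")
    case False
    then obtain i' where i: "i = Suc i'" by (cases i) auto
    with q have q': "i' + j = Suc q" by simp
    have "chain_boundary (Suc q) L = twist q g i (cell_boundary g h c i' j)"
      using chain[of i' j] bd[of i' j] q' by (simp add: L_def i chain_boundary_twist)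
    also have "\<dots> = frag_cmul (- ((-1) ^ i)) D"
    proof -
      have "twist q g i (if i' = 0 then 0 else twist q g i' (c (i' - 1) j)) = 0"
        using chain[of "i' - 1" j] q' invol_g by (auto simp: i intro!: twist_twist_Suc [of _ X])
      then show ?thesis
        using q' by (auto simp: cell_boundary_def twist_add D_def i twist_cmul split: if_splits)
    qed
    finally show ?thesis .
  qed (simp add: L_def D_def)
  moreover have "chain_boundary (Suc q) R = D"
  proof (cases "j = 0")
    case False
    then obtain j' where j: "j = Suc j'" by (cases j) auto
    with q have q': "i + j' = Suc q" by simp
    have "chain_boundary (Suc q) R = twist q h j (cell_boundary g h c i j')"
      using chain[of i j'] bd[of i j'] q' by (simp add: R_def j chain_boundary_twist)
    also have "\<dots> = D"
    proof -
      have "twist q h j (if j' = 0 then 0 else twist q h j' (c i (j' - 1))) = 0"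
        using chain[of i "j' - 1"] q' invol_h by (auto simp: j intro!: twist_twist_Suc [of _ X])
      moreover have "twist q h j (if i = 0 then 0 else twist q g i (c (i - 1) j')) = D"
        using chain[of "i - 1" j'] q' commute
        by (auto simp: D_def j intro!: twist_commute [of _ X])
      ultimately show ?thesis
        using q' by (auto simp: cell_boundary_def twist_add twist_cmul split: if_splits)
    qed
    finally show ?thesis .
  qed (simp add: R_def D_def)
  moreover have "cell_boundary g h c i j = L + frag_cmul ((-1) ^ i) R"
    using q by (auto simp: cell_boundary_def L_def R_def)
  ultimately show ?thesis
    using q by (simp add: chain_boundary_add chain_boundary_cmul flip: frag_cmul_distrib)
qed

text \<open>Subdivision is a natural chain map, so it commutes with boundaries and twists and stays
  in each cell; in degree \<open>0\<close> it is the identity.\<close>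

lemma cell_system_subdivision:
  assumes "cell_system c"
  shows "cell_system (\<lambda>i j. singular_subdivision (i + j) (c i j))"
proof -
  have chain: "singular_chain (i + j) (subtopology X (K i j)) (c i j)" for i j
    using assms by (simp add: cell_system_def)
  have bd: "chain_boundary (i + j) (c i j) = cell_boundary g h c i j" for i j
    using assms by (simp add: cell_system_def)
  have "chain_boundary (i + j) (singular_subdivision (i + j) (c i j))
      = cell_boundary g h (\<lambda>i j. singular_subdivision (i + j) (c i j)) i j" for i j
  proof -
    let ?S = "singular_subdivision (i + j - 1)"
    have L: "?S (twist (i + j - 1) g i (c (i - 1) j))
        = twist (i + j - 1) g i (singular_subdivision (i - 1 + j) (c (i - 1) j))" if "i \<noteq> 0"
      using singular_subdivision_twist [OF chain [of "i - 1" j]] that by simp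
    have R: "?S (twist (i + j - 1) h j (c i (j - 1)))
        = twist (i + j - 1) h j (singular_subdivision (i + (j - 1)) (c i (j - 1)))" if "j \<noteq> 0"
      using singular_subdivision_twist [OF chain [of i "j - 1"]] that by simp
    have cmul: "?S (frag_cmul k x) = frag_cmul k (?S x)" for k and x :: "'a chain"
      by (simp add: singular_subdivision_def frag_extend_cmul)
    have "chain_boundary (i + j) (singular_subdivision (i + j) (c i j)) = ?S (cell_boundary g h c i j)"
      using chain_boundary_singular_subdivision [OF chain [of i j]] bd by simp
    also have "\<dots> = cell_boundary g h (\<lambda>i j. singular_subdivision (i + j) (c i j)) i j"
      using L R cmul by (auto simp: cell_boundary_def singular_subdivision_add)
    finally show ?thesis .
  qed
  moreover have "singular_subdivision 0 (c 0 0) = c 0 0"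
    using chain [of 0 0] singular_subdivision_zero by fastforce
  ultimately show ?thesis
    using assms singular_chain_singular_subdivision [OF chain] by (simp add: cell_system_def)
qed

lemma cell_system_iterated_subdivision:
  "cell_system c \<Longrightarrow> cell_system (\<lambda>i j. (singular_subdivision (i + j) ^^ N) (c i j))"
proof (induction N)
  case (Suc N)
  then show ?case
    using cell_system_subdivision [OF Suc.IH] by simp
qed simp

text \<open>Acyclic carriers: in order of total degree, the prescribed boundary is a cycle in the
  contractible set \<open>K i j\<close> and can be filled there.\<close>

lemma cell_system_exists:
  assumes contr: "\<And>i j. contractible_space (subtopology X (K i j))"
    and nonempty: "topspace X \<inter> K 0 0 \<noteq> {}"
  obtains c where "cell_system c"
proof -
  obtain a where a: "a \<in> topspace X" "a \<in> K 0 0"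
    using nonempty by blast
  let ?s = "restrict (\<lambda>_. a) (standard_simplex 0)"
  let ?P = "\<lambda>c i j x. singular_chain (i + j) (subtopology X (K i j)) x \<and>
                     chain_boundary (i + j) x = cell_boundary g h c i j"
  \<comment> \<open>The recursion is on total degree: \<open>F n i j\<close> is meant only for
    \<open>i + j = n\<close>, and \<open>c\<close> reads off those entries.\<close>
  define F where "F = rec_nat (\<lambda>i j. frag_of ?s) (\<lambda>_ c i j. SOME x. ?P c i j x)"
  define c where "c = (\<lambda>i j. F (i + j) i j)"
  have c00: "c 0 0 = frag_of ?s"
    by (simp add: c_def F_def)
  have "?P c i j (c i j)" for i j
  proof (induction "i + j" arbitrary: i j rule: less_induct)
    case less
    show ?case
    proof (cases "i + j")
      case 0
      have "singular_simplex 0 (subtopology X (K 0 0)) ?s"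
        using a by (auto simp: singular_simplex_def)
      then show ?thesis
        using 0 by (simp add: c00 singular_chain_of cell_boundary_def chain_boundary_def)
    next
      case (Suc n)
      have "F n (i - 1) j = c (i - 1) j" if "i \<noteq> 0"
        using that Suc by (auto simp: c_def)
      moreover have "F n i (j - 1) = c i (j - 1)" if "j \<noteq> 0"
        using that Suc by (auto simp: c_def)
      ultimately have F: "cell_boundary g h (F n) i j = cell_boundary g h c i j"
        by (auto simp: cell_boundary_def)
      have chain: "singular_chain (i' + j') (subtopology X (K i' j')) (c i' j')" if "i' + j' < i + j" for i' j'
        using less that by blast
      have z: "singular_chain n (subtopology X (K i j)) (cell_boundary g h c i j)"
        using singular_chain_cell_boundary [of i j c] chain [of "i - 1" j] chain [of i "j - 1"] Suc
        by auto
      have bd: "chain_boundary n (cell_boundary g h c i j) = 0"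
        using chain_boundary_cell_boundary [of i j c] less chain_in_X Suc by fastforce
      \<comment> \<open>In degree \<open>0\<close> the prescribed boundary is \<open>s - g s\<close>
        or \<open>s - h s\<close> for the base simplex \<open>s\<close>, of augmentation
        zero.\<close>
      have aug: "chain_map 0 (\<lambda>_. b) (cell_boundary g h c i j) = 0" if n0: "n = 0" for b :: 'a
      proof -
        have t: "chain_map 0 (\<lambda>_. b) (twist 0 f 1 (frag_of ?s)) = 0" for f
          by (simp add: twist_def chain_map_diff simplex_map_def o_def cong: restrict_cong)
        consider "i = 1" "j = 0" | "i = 0" "j = 1"
          using Suc n0 by (cases i) auto
        then show ?thesis
          by cases (use t [of g] t [of h] in \<open>simp_all add: cell_boundary_def c00\<close>)
      qed
      have "topspace (subtopology X (K i j)) \<noteq> {}"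
      proof -
        have "K 0 0 \<subseteq> K i 0" by (induction i) (use cell_left in blast)+
        moreover have "K i 0 \<subseteq> K i j" by (induction j) (use cell_right in blast)+
        ultimately show ?thesis using a by auto
      qed
      then have "\<exists>x. ?P c i j x"
        using contractible_cycle_is_boundary [OF contr _ z bd aug] Suc by auto
      moreover have "c i j = (SOME x. ?P c i j x)"
        using Suc F by (simp add: c_def F_def)
      ultimately show ?thesis
        by (metis (mono_tags, lifting) someI_ex)
    qed
  qed
  with c00 have "cell_system c"
    unfolding cell_system_def by blast
  then show thesis
    by (rule that)
qed

text \<open>Stokes' formula passes to \<open>cell_boundary\<close>, and
  \<open>eval_sign_cochain_twist\<close> turns each of its terms into the value on a smaller cell:
  Pascal's rule mod 2.\<close>

lemma eval_sign_cocycle_cell_system: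
  assumes c: "cell_system c"
    and g: "\<And>k x. x \<in> S \<Longrightarrow> e k (g x) = e k x + 1" and h: "\<And>k x. x \<in> S \<Longrightarrow> e k (h x) = e k x + 1"
    and K: "\<And>i j. \<lbrakk>i \<le> d; j \<le> d'\<rbrakk> \<Longrightarrow> K i j \<subseteq> S"
  shows "\<lbrakk>i \<le> d; j \<le> d'\<rbrakk> \<Longrightarrow> eval_sign_cocycle e (i + j) (c i j) = of_nat ((i + j) choose i)"
proof (induction "i + j" arbitrary: i j)
  case 0
  then show ?case
    using c by (auto simp: cell_system_def eval_sign_cocycle_def)
next
  case (Suc n)
  have chain: "singular_chain (i + j) (subtopology X (K i j)) (c i j)" for i j
    using c by (simp add: cell_system_def)
  have n: "i + j = Suc n" using Suc.hyps(2) by simp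
  have bd: "chain_boundary (Suc n) (c i j) = cell_boundary g h c i j"
    using c n by (auto simp: cell_system_def simp flip: n)
  have L: "eval_sign_cochain e n (if i = 0 then 0 else twist (i + j - 1) g i (c (i - 1) j))
      = (if i = 0 then 0 else of_nat (n choose (i - 1)))"
  proof (cases "i = 0")
    case False
    then have n': "n = i - 1 + j" using n by simp
    have "eval_sign_cochain e n (twist n g i (c (i - 1) j)) = eval_sign_cocycle e n (c (i - 1) j)"
      unfolding n'
      by (rule eval_sign_cochain_twist [OF chain]) (rule g, use K [of "i - 1" j] Suc.prems in fastforce)
    also have "\<dots> = of_nat (n choose (i - 1))"
      using Suc.hyps(1) [OF n'] Suc.prems n' by simp
    finally show ?thesis
      using False n by simp
  qed (simp add: eval_sign_cochain_def)
  have R: "eval_sign_cochain e n (if j = 0 then 0 else frag_cmul ((-1) ^ i) (twist (i + j - 1) h j (c i (j - 1))))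
      = (if j = 0 then 0 else of_nat (n choose i))"
  proof (cases "j = 0")
    case False
    then have n': "n = i + (j - 1)" using n by simp
    have "eval_sign_cochain e n (twist n h j (c i (j - 1))) = eval_sign_cocycle e n (c i (j - 1))"
      unfolding n'
      by (rule eval_sign_cochain_twist [OF chain]) (rule h, use K [of i "j - 1"] Suc.prems in fastforce)
    also have "\<dots> = of_nat (n choose i)"
      using Suc.hyps(1) [OF n'] Suc.prems n' by simp
    finally show ?thesis
      using False n
      by (simp add: eval_sign_cochain_def cochain_eval_cmul)
  qed (simp add: eval_sign_cochain_def)
  have "eval_sign_cocycle e (i + j) (c i j) = eval_sign_cochain e n (cell_boundary g h c i j)"
    unfolding n bd [symmetric] by (rule eval_sign_cochain_boundary [symmetric])
  also have "\<dots> = (if i = 0 then 0 else of_nat (n choose (i - 1))) + (if j = 0 then 0 else of_nat (n choose i))"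
    using L R unfolding cell_boundary_def eval_sign_cochain_def cochain_eval_add by simp
  also have "\<dots> = of_nat ((if i = 0 then 0 else n choose (i - 1)) + (if j = 0 then 0 else n choose i))"
    by (simp only: of_nat_add if_distrib [of of_nat] of_nat_0)
  also have "(if i = 0 then 0 else n choose (i - 1)) + (if j = 0 then 0 else n choose i) = (i + j) choose i"
    unfolding n using n by (cases i; cases j) auto
  finally show ?case .
qed

end

section \<open>A Borsuk--Ulam theorem for products of spheres\<close>

lemma nsphere_eq_top_of_set: "nsphere n = top_of_set (topspace (nsphere n))"
  by (simp add: nsphere euclidean_product_topology)

lemma in_topspace_nsphere_iff:
  "x \<in> topspace (nsphere n) \<longleftrightarrow> (\<Sum>i\<le>n. x i ^ 2) = 1 \<and> (\<forall>i>n. x i = 0)"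
  by (simp add: nsphere)

lemma prod_nsphere_eq_top_of_set:
  "prod_topology (nsphere m) (nsphere n) = top_of_set (topspace (nsphere m) \<times> topspace (nsphere n))"
  by (metis nsphere_eq_top_of_set prod_topology_subtopology_eu)

text \<open>The closed cell of dimension \<open>n\<close> in the antipodal cell structure: with its
  negative it covers the sphere, and for \<open>n = 0\<close> it is a point.\<close>

definition upper_hemisphere :: "nat \<Rightarrow> (nat \<Rightarrow> real) set" where
  "upper_hemisphere n = {x \<in> topspace (nsphere n). 0 \<le> x n}"

lemma upper_hemisphere_subset_nsphere: "i \<le> n \<Longrightarrow> upper_hemisphere i \<subseteq> topspace (nsphere n)"
proof
  fix x assume i: "i \<le> n" and x: "x \<in> upper_hemisphere i"
  then have "(\<Sum>k\<le>n. x k ^ 2) = (\<Sum>k\<le>i. x k ^ 2)"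
    by (intro sum.mono_neutral_right) (auto simp: upper_hemisphere_def in_topspace_nsphere_iff)
  then show "x \<in> topspace (nsphere n)"
    using i x by (auto simp: upper_hemisphere_def in_topspace_nsphere_iff)
qed

lemma upper_hemisphere_Suc:
  assumes "x \<in> upper_hemisphere n"
  shows "x \<in> upper_hemisphere (Suc n)" "(\<lambda>k. - x k) \<in> upper_hemisphere (Suc n)"
  using assms by (auto simp: upper_hemisphere_def in_topspace_nsphere_iff)

text \<open>The segment to the pole \<open>e\<close>, normalised to length one. It avoids the
  origin: a zero last coordinate forces \<open>t = 0\<close>, where the point is \<open>x\<close>
  itself.\<close>

lemma contractible_upper_hemisphere: "contractible (upper_hemisphere n)"
proof -
  let ?S = "upper_hemisphere n"
  define e where "e = (\<lambda>k::nat. if k = n then 1 else 0 :: real)"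
  define y where "y = (\<lambda>(t, x) k. (1 - t) * x k + t * e k)"
  define q where "q = (\<lambda>p. \<Sum>i\<le>n. y p i ^ 2)"
  define h where "h = (\<lambda>p k. y p k / sqrt (q p))"
  have q_pos: "q p > 0" if pS: "p \<in> {0..1} \<times> ?S" for p
  proof -
    obtain t x where p: "p = (t, x)" and t: "0 \<le> t" "t \<le> 1" and x: "(\<Sum>i\<le>n. x i ^ 2) = 1" "0 \<le> x n"
      using pS by (auto simp: upper_hemisphere_def in_topspace_nsphere_iff)
    have "q p \<noteq> 0"
    proof
      assume "q p = 0"
      then have y0: "\<And>i. i \<le> n \<Longrightarrow> y p i = 0"
        by (auto simp: q_def sum_nonneg_eq_0_iff)
      have "(1 - t) * x n + t = 0"
        using y0 [of n] by (simp add: y_def p e_def)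
      moreover have "(1 - t) * x n \<ge> 0"
        using t x by simp
      ultimately have "t = 0"
        using t by linarith
      then have "\<And>i. i \<le> n \<Longrightarrow> x i = 0"
        using y0 by (simp add: y_def p)
      with x(1) show False by simp
    qed
    moreover have "q p \<ge> 0"
      by (simp add: q_def sum_nonneg)
    ultimately show ?thesis by simp
  qed
  have cy: "continuous_on ({0..1} \<times> ?S) (\<lambda>p. y p k)" for k
  proof -
    have "continuous_on ({0..1} \<times> ?S) (\<lambda>p. snd p k)"
      by (rule continuous_on_product_then_coordinatewise) (intro continuous_intros)
    then show ?thesis
      unfolding y_def case_prod_beta by (intro continuous_intros)
  qed
  have "continuous_on ({0..1} \<times> ?S) h"
    unfolding h_def
  proof (rule continuous_on_coordinatewise_then_product)
    fix k
    show "continuous_on ({0..1} \<times> ?S) (\<lambda>p. y p k / sqrt (q p))"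
    proof (intro continuous_on_divide continuous_on_real_sqrt cy ballI)
      show "continuous_on ({0..1} \<times> ?S) q"
        unfolding q_def by (intro continuous_on_sum continuous_on_power cy)
      show "sqrt (q p) \<noteq> 0" if "p \<in> {0..1} \<times> ?S" for p
        using q_pos [OF that] by simp
    qed
  qed
  moreover have "h p \<in> ?S" if "p \<in> {0..1} \<times> ?S" for p
  proof -
    have "(\<Sum>i\<le>n. h p i ^ 2) = q p / q p"
      using q_pos [OF that] by (simp add: h_def power_divide q_def flip: sum_divide_distrib)
    then show ?thesis
      using that q_pos [OF that]
      by (auto simp: upper_hemisphere_def in_topspace_nsphere_iff h_def y_def e_def)
  qed
  moreover have "h (0, x) = x" if "x \<in> ?S" for x
    using that by (auto simp: h_def y_def q_def upper_hemisphere_def in_topspace_nsphere_iff)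
  moreover have "h (1, x) = e" for x
    by (auto simp: h_def y_def q_def e_def if_distrib [where f = "\<lambda>x. x ^ 2"] cong: if_cong)
  ultimately have "homotopic_with_canon (\<lambda>_. True) ?S ?S id (\<lambda>_. e)"
    by (intro homotopic_with [THEN iffD2] exI [of _ h] conjI) 
      (auto simp: image_subset_iff)
  then show ?thesis
    unfolding contractible_def by blast
qed

lemma continuous_on_act: "continuous_on S (act g)"
proof -
  have "continuous_on S (\<lambda>p k. - fst p k :: real)"
    by (rule continuous_on_coordinatewise_then_product, rule continuous_on_minus,
        rule continuous_on_product_then_coordinatewise, rule continuous_on_fst, rule continuous_on_id)
  moreover have "continuous_on S (\<lambda>p k. - snd p k :: real)"
    by (rule continuous_on_coordinatewise_then_product, rule continuous_on_minus,
        rule continuous_on_product_then_coordinatewise, rule continuous_on_snd, rule continuous_on_id)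
  ultimately show ?thesis
    unfolding act_def
    by (cases "fst g = 1"; cases "snd g = 1")
      (auto intro!: continuous_on_Pair continuous_on_fst continuous_on_snd continuous_on_id)
qed

text \<open>With all pairs of sequences as the space, hemispheres of every dimension live together
  and \<open>i\<close>, \<open>j\<close> need no bound.\<close>

interpretation sphere_product: commuting_involutions euclidean "act g1" "act g2"
  "\<lambda>i j. upper_hemisphere i \<times> upper_hemisphere j"
proof
  show "continuous_map euclidean euclidean (act g1)" "continuous_map euclidean euclidean (act g2)"
    by (simp_all add: continuous_on_act)
qed (auto simp: act_g1 act_g2 upper_hemisphere_Suc)

lemma sphere_product_cell_system_exists:
  obtains c where "sphere_product.cell_system c"
proof (rule sphere_product.cell_system_exists)
  fix i j
  show "contractible_space (top_of_set (upper_hemisphere i \<times> upper_hemisphere j))"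
    using contractible_upper_hemisphere
    by (simp add: contractible_space_prod_topology flip: prod_topology_subtopology_eu contractible_space_top_of_set)
next
  have "(\<lambda>k. if k = 0 then 1 else 0) \<in> upper_hemisphere 0"
    by (simp add: upper_hemisphere_def in_topspace_nsphere_iff)
  then show "topspace euclidean \<inter> upper_hemisphere 0 \<times> upper_hemisphere 0 \<noteq> {}"
    by auto
qed

lemma of_nat_bit_eq_of_bool_odd: "(of_nat n :: bit) = of_bool (odd n)"
  by (induction n) auto

theorem borsuk_ulam_sphere_product:
  fixes F :: "nat \<Rightarrow> (nat \<Rightarrow> real) \<times> (nat \<Rightarrow> real) \<Rightarrow> real"
  assumes "odd ((m + n) choose m)"
    and cont: "\<And>k. k < m + n \<Longrightarrow> continuous_map (prod_topology (nsphere m) (nsphere n)) euclideanreal (F k)"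
    and odd1: "\<And>k p. \<lbrakk>k < m + n; p \<in> topspace (prod_topology (nsphere m) (nsphere n))\<rbrakk>
                 \<Longrightarrow> F k (act g1 p) = - F k p"
    and odd2: "\<And>k p. \<lbrakk>k < m + n; p \<in> topspace (prod_topology (nsphere m) (nsphere n))\<rbrakk>
                 \<Longrightarrow> F k (act g2 p) = - F k p"
  obtains p where "p \<in> topspace (prod_topology (nsphere m) (nsphere n))" "\<And>k. k < m + n \<Longrightarrow> F k p = 0"
proof (rule ccontr)
  note zero = that
  assume "\<not> thesis"
  define S where "S = topspace (prod_topology (nsphere m) (nsphere n))"
  have top: "prod_topology (nsphere m) (nsphere n) = top_of_set S"
    unfolding S_def by (simp add: prod_nsphere_eq_top_of_set)
  have nz: "\<exists>k<m + n. F k p \<noteq> 0" if "p \<in> S" for p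
    using \<open>\<not> thesis\<close> that zero unfolding S_def by blast
  \<comment> \<open>Where \<open>F k p = 0\<close>, the sign of the first nonzero coordinate is used, so that \<open>e k\<close> flips everywhere.\<close>
  define first where "first = (\<lambda>p. LEAST k. k < m + n \<and> F k p \<noteq> 0)"
  define e :: "nat \<Rightarrow> (nat \<Rightarrow> real) \<times> (nat \<Rightarrow> real) \<Rightarrow> bit"
    where "e = (\<lambda>k p. of_bool (0 < (if k < m + n \<and> F k p \<noteq> 0 then F k p else F (first p) p)))"
  have flip: "e k (act g p) = e k p + 1"
    if "p \<in> S" "\<And>k. k < m + n \<Longrightarrow> F k (act g p) = - F k p" for g k p
  proof -
    \<comment> \<open>Negation preserves which coordinates vanish.\<close>
    have "first (act g p) = first p"
      unfolding first_def by (rule arg_cong [where f = Least]) (use that in auto)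
    moreover have "first p < m + n \<and> F (first p) p \<noteq> 0"
      unfolding first_def by (rule LeastI_ex) (use nz that in blast)
    ultimately show ?thesis
      using that(2) [of k] that(2) [of "first p"] by (auto simp: e_def)
  qed
  define \<C> where "\<C> = (\<Union>k\<in>{..<m + n}. {{p \<in> S. F k p \<in> {0<..}}, {p \<in> S. F k p \<in> {..<0}}})"
  obtain c where c: "sphere_product.cell_system c"
    by (rule sphere_product_cell_system_exists)
  have sub: "upper_hemisphere i \<times> upper_hemisphere j \<subseteq> S" if "i \<le> m" "j \<le> n" for i j
    using upper_hemisphere_subset_nsphere [OF that(1)] upper_hemisphere_subset_nsphere [OF that(2)]
    by (auto simp: S_def)
  have "singular_chain (m + n) (top_of_set (upper_hemisphere m \<times> upper_hemisphere n)) (c m n)"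
    using c by (simp add: sphere_product.cell_system_def)
  then have chain: "singular_chain (m + n) (top_of_set S) (c m n)"
    by (rule singular_chain_mono) (use sub in simp)
  have "openin (top_of_set S) U" if "U \<in> \<C>" for U
  proof -
    have "openin (top_of_set S) {p \<in> topspace (top_of_set S). F k p \<in> V}" if "k < m + n" "open V" for k V
      using cont [OF that(1)] that(2) unfolding top
      by (intro openin_continuous_map_preimage [where Y = euclideanreal]) auto
    from this [of _ "{0<..}"] this [of _ "{..<0}"] show ?thesis
      using that by (auto simp: \<C>_def)
  qed
  moreover have "topspace (top_of_set S) \<subseteq> \<Union>\<C>"
    using nz by (fastforce simp: \<C>_def neq_iff)
  ultimately obtain N where N: "\<And>N' s. \<lbrakk>N \<le> N'; s \<in> Poly_Mapping.keys ((singular_subdivision (m + n) ^^ N') (c m n))\<rbrakk>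
      \<Longrightarrow> \<exists>V\<in>\<C>. s \<in> standard_simplex (m + n) \<rightarrow> V"
    using sufficient_iterated_singular_subdivision_exists [OF _ _ chain] by metis
  let ?c = "(singular_subdivision (m + n) ^^ N) (c m n)"
  have "sign_cocycle e (m + n) (simplex_vertices s) = 0" if s: "s \<in> Poly_Mapping.keys ?c" for s
  proof -
    obtain V where V: "V \<in> \<C>" "s \<in> standard_simplex (m + n) \<rightarrow> V"
      using N s by blast
    then have vert: "simplex_vertices s i \<in> V" if "i \<le> m + n" for i
      using that by (auto simp: simplex_vertices_def Pi_iff)
    from V(1) obtain k where k: "k < m + n" "V = {p \<in> S. F k p > 0} \<or> V = {p \<in> S. F k p < 0}"
      by (auto simp: \<C>_def)
    \<comment> \<open>On a member of the cover \<open>F k\<close> is nonzero with a fixed sign, so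
      \<open>e k\<close> never uses its fallback there.\<close>
    then obtain z where "\<And>p. p \<in> V \<Longrightarrow> e k p = z"
      by (auto simp: e_def)
    then show ?thesis
      using vert by (intro sign_cocycle_eq_0 [OF k(1)]) auto
  qed
  then have "eval_sign_cocycle e (m + n) ?c = 0"
    by (simp add: eval_sign_cocycle_def cochain_eval_def)
  moreover have "eval_sign_cocycle e (m + n) ?c = of_nat ((m + n) choose m)"
  proof (rule sphere_product.eval_sign_cocycle_cell_system)
    show "sphere_product.cell_system (\<lambda>i j. (singular_subdivision (i + j) ^^ N) (c i j))"
      by (rule sphere_product.cell_system_iterated_subdivision [OF c])
    show "e k (act g1 p) = e k p + 1" if "p \<in> S" for k p
      by (rule flip [OF that]) (use odd1 that in \<open>simp add: S_def\<close>)
    show "e k (act g2 p) = e k p + 1" if "p \<in> S" for k p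
      by (rule flip [OF that]) (use odd2 that in \<open>simp add: S_def\<close>)
  qed (use sub in auto)
  ultimately show False
    using assms(1) by (simp add: of_nat_bit_eq_of_bool_odd)
qed

section \<open>Affine dependences and convex hulls\<close>

text \<open>Neighbouring entries of row \<open>2 ^ s - 1\<close> add up to an inner entry of row
  \<open>2 ^ s\<close>. That entry is even, since otherwise \<open>2 ^ s\<close> would divide
  \<open>Suc k\<close>, so oddness spreads from \<open>k = 0\<close>.\<close>

lemma odd_binomial_Mersenne: "k < 2 ^ s \<Longrightarrow> odd ((2 ^ s - 1) choose k)"
proof (induction k)
  case (Suc k)
  define n where "n = (2 ^ s - 1 :: nat)"
  have n: "Suc n = 2 ^ s" by (simp add: n_def)
  have "even (Suc n choose Suc k)"
  proof (rule ccontr)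
    assume "odd (Suc n choose Suc k)"
    then have "coprime (2 ^ s) (Suc n choose Suc k)"
      by simp
    moreover have "Suc n dvd Suc k * (Suc n choose Suc k)"
      unfolding Suc_times_binomial by (rule dvd_triv_left)
    ultimately have "2 ^ s dvd Suc k"
      unfolding n by (simp only: coprime_dvd_mult_left_iff)
    then show False
      using Suc.prems dvd_imp_le [of "2 ^ s" "Suc k"] by linarith
  qed
  moreover have "odd (n choose k)"
    using Suc n_def by simp
  ultimately have "odd (n choose Suc k)"
    by simp
  then show ?case
    by (simp add: n_def)
qed simp

section \<open>Compactness of spheres and invariance of the metric\<close>

lemma compact_nsphere: "compact (topspace (nsphere n))"
proof -
  \<comment> \<open>Tychonoff: the sphere is a closed subset of a compact infinite cube.\<close>
  have "compact (UNIV \<rightarrow>\<^sub>E {- 1..1} :: (nat \<Rightarrow> real) set)"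
    using compactin_PiE [of "\<lambda>_. euclideanreal" UNIV "\<lambda>_::nat. {- 1..1}"]
    by (simp add: euclidean_product_topology)
  moreover have "closed (topspace (nsphere n))"
  proof -
    have "topspace (nsphere n) = {x. (\<Sum>i\<le>n. x i ^ 2) = 1} \<inter> (\<Inter>i\<in>{n<..}. {x. x i = 0})"
      by (auto simp: nsphere)
    also have "closed \<dots>"
      by (intro closed_Int closed_INT ballI closed_Collect_eq continuous_intros continuous_on_product_coordinates)
    finally show ?thesis .
  qed
  moreover have "topspace (nsphere n) \<subseteq> UNIV \<rightarrow>\<^sub>E {- 1..1}"
  proof
    fix x assume x: "x \<in> topspace (nsphere n)"
    have "\<bar>x k\<bar> \<le> 1" for k
    proof (cases "k \<le> n")
      case True
      then have "x k ^ 2 \<le> (\<Sum>i\<le>n. x i ^ 2)"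
        by (intro member_le_sum) auto
      then show ?thesis
        using x by (simp add: nsphere abs_square_le_1)
    qed (use x in \<open>simp add: nsphere\<close>)
    then show "x \<in> UNIV \<rightarrow>\<^sub>E {- 1..1}"
      by (auto simp: abs_le_iff)
  qed
  ultimately show ?thesis
    by (metis compact_Int_closed inf.absorb2 inf_commute)
qed

text \<open>The metric on sequences is built from coordinate distances, which negation
  preserves.\<close>

lemma dist_act: "dist (act g p) (act g q) = dist p q"
  by (simp add: act_def dist_prod_def dist_fun_def dist_minus)

lemma infdist_act: "infdist (act g p) (act g ` B) = infdist p B"
  by (simp add: infdist_def dist_act image_image)

lemma act_image_image: "act g ` act h ` B = act (g + h) ` B"
  by (simp add: image_image act_add)

section \<open>Convex combinations of sequences\<close>

lemma seq_convex_hull: "seq_convex (seq_convex hull S)"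
  by (rule hull_in) (auto simp: seq_convex_def)

lemma seq_convex_weighted_mean:
  assumes "finite I" "I \<noteq> {}" "seq_convex C" "\<And>i. i \<in> I \<Longrightarrow> x i \<in> C" "\<And>i. i \<in> I \<Longrightarrow> 0 < u i"
  shows "(\<lambda>k. (\<Sum>i\<in>I. u i * x i k) / sum u I) \<in> C"
  using assms
proof (induction I rule: finite_ne_induct)
  case (singleton i)
  then show ?case
    by (simp add: order_less_imp_not_eq2)
next
  case (insert i I)
  have pos: "0 < u i" "0 < sum u I"
    using insert.prems insert.hyps by (auto intro: sum_pos)
  have y: "(\<lambda>k. (\<Sum>i\<in>I. u i * x i k) / sum u I) \<in> C"
    by (rule insert.IH) (use insert.prems in auto)
  have "(\<lambda>k. u i / (u i + sum u I) * x i k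
      + sum u I / (u i + sum u I) * ((\<Sum>i\<in>I. u i * x i k) / sum u I)) \<in> C"
    using insert.prems(1) [unfolded seq_convex_def, rule_format, OF insert.prems(2) [of i] y,
        of "u i / (u i + sum u I)" "sum u I / (u i + sum u I)"] pos
    by (simp add: add_divide_distrib [symmetric])
  moreover have "u i / (u i + sum u I) * x i k
      + sum u I / (u i + sum u I) * ((\<Sum>i\<in>I. u i * x i k) / sum u I)
      = (\<Sum>i\<in>insert i I. u i * x i k) / sum u (insert i I)" for k
    using pos insert.hyps by (simp add: add_divide_distrib)
  ultimately show ?case
    by simp
qed

text \<open>Radon's argument: moving the negative terms to the other side gives two positive
  combinations with equal weight and equal value; dividing by the weight gives a common
  point.\<close>

lemma seq_convex_hulls_meet:
  fixes u :: "nat \<Rightarrow> real"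
  assumes I: "finite I" and nz: "\<exists>i\<in>I. u i \<noteq> 0" and sum0: "sum u I = 0"
    and sumx: "\<And>k. (\<Sum>i\<in>I. u i * x i k) = 0"
  shows "(seq_convex hull (x ` {i \<in> I. u i < 0})) \<inter> (seq_convex hull (x ` {i \<in> I. 0 < u i})) \<noteq> {}"
proof -
  define N where "N = {i \<in> I. u i < 0}"
  define P where "P = {i \<in> I. 0 < u i}"
  have fin: "finite N" "finite P" using I by (auto simp: N_def P_def)
  have split: "(\<Sum>i\<in>I. u i * f i) = (\<Sum>i\<in>P. u i * f i) + (\<Sum>i\<in>N. u i * f i)" for f
  proof -
    have "(\<Sum>i\<in>I. u i * f i) = (\<Sum>i\<in>P \<union> N. u i * f i)"
    proof (rule sum.mono_neutral_right [OF I])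
      show "P \<union> N \<subseteq> I" by (auto simp: N_def P_def)
      show "\<forall>i\<in>I - (P \<union> N). u i * f i = 0"
        by (metis (mono_tags, lifting) Diff_iff UnI1 UnI2 N_def P_def mem_Collect_eq mult_zero_left linorder_neqE_linordered_idom)
    qed
    also have "\<dots> = (\<Sum>i\<in>P. u i * f i) + (\<Sum>i\<in>N. u i * f i)"
    proof (rule sum.union_disjoint [OF fin(2,1)])
      show "P \<inter> N = {}"
        unfolding N_def P_def by force
    qed
    finally show ?thesis .
  qed
  have w: "sum u P = (\<Sum>i\<in>N. - u i)"
    using split [of "\<lambda>_. 1"] sum0 by (simp add: sum_negf)
  have x: "(\<Sum>i\<in>P. u i * x i k) = (\<Sum>i\<in>N. - u i * x i k)" for k
    using split [of "\<lambda>i. x i k"] sumx [of k] by (simp add: sum_negf)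
  \<comment> \<open>A nonempty side has positive weight, and the two weights agree, so neither side
    is empty.\<close>
  have "N \<noteq> {} \<and> P \<noteq> {}"
  proof -
    have "N \<noteq> {} \<or> P \<noteq> {}" using nz by (force simp: N_def P_def)
    moreover have "0 < (\<Sum>i\<in>N. - u i)" if "N \<noteq> {}"
      using that fin by (intro sum_pos) (auto simp: N_def)
    moreover have "0 < sum u P" if "P \<noteq> {}"
      using that fin by (intro sum_pos) (auto simp: P_def)
    ultimately show ?thesis using w by fastforce
  qed
  then have "(\<lambda>k. (\<Sum>i\<in>P. u i * x i k) / sum u P) \<in> seq_convex hull (x ` P)"
    "(\<lambda>k. (\<Sum>i\<in>N. - u i * x i k) / (\<Sum>i\<in>N. - u i)) \<in> seq_convex hull (x ` N)"
    by (intro seq_convex_weighted_mean fin seq_convex_hull; force simp: N_def P_def intro: hull_inc)+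
  then show ?thesis
    unfolding x w N_def [symmetric] P_def [symmetric] by blast
qed

text \<open>A difference of tents of radius \<epsilon>. Since \<open>infdist\<close> to the empty
  set is \<open>0\<close>, later lemmas assume nonempty sets, and two empty sets give the zero
  function.\<close>

definition bump :: "real \<Rightarrow> 'a::metric_space set \<Rightarrow> 'a set \<Rightarrow> 'a \<Rightarrow> real" where
  "bump \<epsilon> P N p = max 0 (\<epsilon> - infdist p P) - max 0 (\<epsilon> - infdist p N)"

lemma bump_swap: "bump \<epsilon> N P p = - bump \<epsilon> P N p"
  by (simp add: bump_def)

lemma continuous_on_bump: "continuous_on S (bump \<epsilon> P N)"
  unfolding bump_def by (intro continuous_intros)

lemma bump_pos:
  assumes "0 < \<epsilon>" "closed N" "N \<noteq> {}" "p \<in> P" "p \<notin> N"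
  shows "0 < bump \<epsilon> P N p"
proof -
  have "0 < infdist p N"
    using assms by (simp add: infdist_pos_not_in_closed)
  then show ?thesis
    using assms by (auto simp: bump_def max_def)
qed

text \<open>The distance from \<open>q n\<close> to \<open>P\<close> tends to a positive limit while
  the radius tends to \<open>0\<close>, so the tent around \<open>P\<close> eventually vanishes at
  \<open>q n\<close>.\<close>

lemma eventually_bump_nonpos:
  assumes lim: "q \<longlonglongrightarrow> p" "\<epsilon> \<longlonglongrightarrow> 0" and P: "closed P" "P \<noteq> {}" "p \<notin> P"
  shows "eventually (\<lambda>n. bump (\<epsilon> n) P N (q n) \<le> 0) sequentially"
proof -
  have "0 < infdist p P"
    using P by (simp add: infdist_pos_not_in_closed)
  moreover have "(\<lambda>n. infdist (q n) P - \<epsilon> n) \<longlonglongrightarrow> infdist p P - 0"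
    by (intro tendsto_intros lim)
  ultimately have "eventually (\<lambda>n. infdist (q n) P - \<epsilon> n > 0) sequentially"
    by (auto dest: order_tendstoD(1))
  then show ?thesis
    by (rule eventually_mono) (simp add: bump_def)
qed

section \<open>Common zeros for shrinking radii and their limit\<close>

theorem theorem6p2:
  fixes t d m :: nat
    and x :: "nat \<Rightarrow> (nat \<Rightarrow> real)"
    and A :: "nat \<Rightarrow> ((nat \<Rightarrow> real) \<times> (nat \<Rightarrow> real)) set"
  assumes "d = 2 ^ t"
    and "m \<ge> 1"
    and "\<And>i. i \<in> {1..m} \<Longrightarrow> x i \<in> topspace (Euclidean_space (2 * d - 2))"
    and "\<And>i. i \<in> {1..m} \<Longrightarrow> closedin (prod_topology (nsphere d) (nsphere (d - 1))) (A i)"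
    and "\<And>i. i \<in> {1..m} \<Longrightarrow> A i \<inter> act g1 ` A i = {}"
    and "\<And>i. i \<in> {1..m} \<Longrightarrow> A i \<inter> act g2 ` A i = {}"
    and "(\<Union>i\<in>{1..m}. G_orbit (A i)) = topspace (prod_topology (nsphere d) (nsphere (d - 1)))"
  shows "\<exists>S T \<alpha> \<beta>. S \<subseteq> {1..m} \<and> T \<subseteq> {1..m} \<and> S \<inter> T = {} \<and>
           \<alpha> \<in> S \<rightarrow> {g1, g2} \<and> \<beta> \<in> T \<rightarrow> {0, g1 + g2} \<and>
           (seq_convex hull (x ` S)) \<inter> (seq_convex hull (x ` T)) \<noteq> {} \<and>
           (\<Inter>i\<in>S. act (\<alpha> i) ` A i) \<inter> (\<Inter>i\<in>T. act (\<beta> i) ` A i) \<noteq> {}"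
proof -
  define M where "M = topspace (prod_topology (nsphere d) (nsphere (d - 1)))"
  define P where "P = (\<lambda>i. A i \<union> act (g1 + g2) ` A i)"
  define N where "N = (\<lambda>i. act g1 ` A i \<union> act g2 ` A i)"
  have d: "d + (d - 1) = 2 * d - 1" "2 * d - 1 = 2 ^ Suc t - 1" "0 < d"
    using assms(1) by simp_all
  have M: "prod_topology (nsphere d) (nsphere (d - 1)) = top_of_set M"
    by (simp add: M_def prod_nsphere_eq_top_of_set)
  have compact_M: "compact M"
    by (simp add: M_def compact_Times compact_nsphere)
  have act_M: "act g p \<in> M" if "p \<in> M" for g p
    using that act_sphere_product unfolding M_def by blast
  have act_compact: "compact (act g ` A i)" if "i \<in> {1..m}" for g i
  proof -
    have "closedin (top_of_set M) (A i)"
      using assms(4) [OF that] unfolding M .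
    then have "compact (A i)"
      using compact_M closedin_compact by blast
    then show ?thesis
      by (rule compact_continuous_image [OF continuous_on_act])
  qed
  have closed: "closed (P i)" "closed (N i)" if "i \<in> {1..m}" for i
  proof -
    have "compact (A i)"
      using act_compact [OF that, of 0] by (simp add: act_zero)
    then show "closed (P i)" "closed (N i)"
      unfolding P_def N_def by (simp_all add: compact_imp_closed compact_Un act_compact [OF that])
  qed
  have klein: "g1 + g1 = 0" "g2 + g2 = 0" "g1 + (g1 + g2) = g2" "g2 + (g1 + g2) = g1" "g2 + g1 = g1 + g2"
    by (simp_all add: g1_def g2_def zero_prod_def)
  have swap: "act g1 ` P i = N i" "act g1 ` N i = P i" "act g2 ` P i = N i" "act g2 ` N i = P i" for i
    unfolding P_def N_def image_Un act_image_image klein by (auto simp: act_zero)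
  have disj: "P i \<inter> N i = {}" if "i \<in> {1..m}" for i
  proof -
    have "g + g = 0" for g :: klein
      by (cases g) (simp add: zero_prod_def)
    then have inj: "inj (act g)" for g
      by (intro inj_on_inverseI [of _ "act g"]) (simp add: act_zero flip: act_add)
    have "act g1 ` (A i \<inter> act g2 ` A i) = {}" "act g2 ` (A i \<inter> act g1 ` A i) = {}"
      using assms(5,6) [OF that] by simp_all
    then have "act g1 ` A i \<inter> act (g1 + g2) ` A i = {}" "act g2 ` A i \<inter> act (g1 + g2) ` A i = {}"
      by (simp_all add: image_Int [OF inj] act_image_image klein)
    then show ?thesis
      using assms(5,6) [OF that] by (auto simp: P_def N_def)
  qed
  have odd_bump: "bump \<epsilon> (P i) (N i) (act g p) = - bump \<epsilon> (P i) (N i) p" if "g \<in> {g1, g2}" for \<epsilon> i g p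
  proof -
    have "bump \<epsilon> (act g ` N i) (act g ` P i) (act g p) = bump \<epsilon> (N i) (P i) p"
      by (simp add: bump_def infdist_act)
    then show ?thesis
      using that swap by (auto simp: bump_swap [of _ "N i" "P i"])
  qed
  have ex: "\<exists>q. q \<in> M \<and> (\<Sum>i=1..m. bump \<epsilon> (P i) (N i) q) = 0 \<and>
          (\<forall>k. (\<Sum>i=1..m. bump \<epsilon> (P i) (N i) q * x i k) = 0)" for \<epsilon>
  proof -
    \<comment> \<open>The first \<open>2 * d - 2\<close> functions are the coordinates of the
      weighted sum of the \<open>x i\<close>; index \<open>2 * d - 2\<close> is the sum of the
      weights. Together there are \<open>d + (d - 1)\<close>.\<close>
    define F where "F = (\<lambda>k q. \<Sum>i=1..m. bump \<epsilon> (P i) (N i) q * (if k < 2 * d - 2 then x i k else 1))"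
    have F_odd: "F k (act g p) = - F k p" if "g \<in> {g1, g2}" for k p g
      by (simp add: F_def odd_bump [OF that] sum_negf)
    obtain q where q: "q \<in> M" "\<And>k. k < d + (d - 1) \<Longrightarrow> F k q = 0"
    proof (rule borsuk_ulam_sphere_product [of d "d - 1" F])
      show "odd (d + (d - 1) choose d)"
        unfolding d(1,2) by (rule odd_binomial_Mersenne) (simp add: assms(1))
      show "continuous_map (prod_topology (nsphere d) (nsphere (d - 1))) euclideanreal (F k)" for k
        unfolding M F_def by (auto intro!: continuous_intros continuous_on_bump)
    qed (auto simp: F_odd M_def)
    have "(\<Sum>i=1..m. bump \<epsilon> (P i) (N i) q * x i k) = 0" for k
    proof (cases "k < 2 * d - 2")
      case True
      then show ?thesis using q(2) [of k] by (simp add: F_def)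
    next
      case False
      then have "x i k = 0" if "i \<in> {1..m}" for i
        using assms(3) [OF that] by (simp add: topspace_Euclidean_space)
      then show ?thesis by simp
    qed
    moreover have "(\<Sum>i=1..m. bump \<epsilon> (P i) (N i) q) = 0"
      using q(2) [of "2 * d - 2"] d by (simp add: F_def)
    ultimately show ?thesis
      using q(1) by blast
  qed
  define q where "q = (\<lambda>\<epsilon>. SOME q. q \<in> M \<and> (\<Sum>i=1..m. bump \<epsilon> (P i) (N i) q) = 0 \<and>
          (\<forall>k. (\<Sum>i=1..m. bump \<epsilon> (P i) (N i) q * x i k) = 0))"
  have q: "q \<epsilon> \<in> M" "(\<Sum>i=1..m. bump \<epsilon> (P i) (N i) (q \<epsilon>)) = 0"
    "(\<Sum>i=1..m. bump \<epsilon> (P i) (N i) (q \<epsilon>) * x i k) = 0" for \<epsilon> k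
    using someI_ex [OF ex [of \<epsilon>]] by (auto simp: q_def)
  obtain l r where l: "l \<in> M" "strict_mono r" "((\<lambda>n. q (inverse (real (Suc n)))) \<circ> r) \<longlonglongrightarrow> l"
    using compact_M q(1) unfolding compact_def by meson
  define \<epsilon> where "\<epsilon> = (\<lambda>n. inverse (real (Suc (r n))))"
  have \<epsilon>_pos: "0 < \<epsilon> n" for n by (simp add: \<epsilon>_def)
  have \<epsilon>_lim: "\<epsilon> \<longlonglongrightarrow> 0"
    using LIMSEQ_subseq_LIMSEQ [OF LIMSEQ_inverse_real_of_nat l(2)] by (simp add: \<epsilon>_def o_def)
  have q_lim: "(\<lambda>n. q (\<epsilon> n)) \<longlonglongrightarrow> l"
    using l(3) by (simp add: \<epsilon>_def o_def)
  let ?u = "\<lambda>n i. bump (\<epsilon> n) (P i) (N i) (q (\<epsilon> n))"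
  have "eventually (\<lambda>n. (0 < ?u n i \<longrightarrow> l \<in> P i) \<and> (?u n i < 0 \<longrightarrow> l \<in> N i)) sequentially"
    if i: "i \<in> {1..m}" for i
  \<comment> \<open>For empty \<open>A i\<close> the weight is identically zero, so both
    implications hold vacuously.\<close>
  proof (cases "A i = {}")
    case True
    then show ?thesis by (simp add: P_def N_def bump_def)
  next
    case False
    then have ne: "P i \<noteq> {}" "N i \<noteq> {}" by (auto simp: P_def N_def)
    have "eventually (\<lambda>n. 0 < ?u n i \<longrightarrow> l \<in> P i) sequentially"
    proof (cases "l \<in> P i")
      case False
      show ?thesis
        using eventually_bump_nonpos [OF q_lim \<epsilon>_lim closed(1) [OF i] ne(1) False, of "N i"]
        by (rule eventually_mono) simp
    qed simp
    moreover have "eventually (\<lambda>n. ?u n i < 0 \<longrightarrow> l \<in> N i) sequentially"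
    proof (cases "l \<in> N i")
      case False
      show ?thesis
        using eventually_bump_nonpos [OF q_lim \<epsilon>_lim closed(2) [OF i] ne(2) False, of "P i"]
        by (rule eventually_mono) (simp add: bump_swap [of _ "N i" "P i"])
    qed simp
    ultimately show ?thesis
      by (rule eventually_conj)
  qed
  then have "eventually (\<lambda>n. \<forall>i\<in>{1..m}. (0 < ?u n i \<longrightarrow> l \<in> P i) \<and> (?u n i < 0 \<longrightarrow> l \<in> N i)) sequentially"
    by (intro eventually_ball_finite) auto
  then obtain n where n: "\<forall>i\<in>{1..m}. (0 < ?u n i \<longrightarrow> l \<in> P i) \<and> (?u n i < 0 \<longrightarrow> l \<in> N i)"
    using eventually_happens'[OF sequentially_bot] by blast
  \<comment> \<open>One index \<open>n\<close> serves all \<open>i\<close>: the weights are taken at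
    \<open>q (\<epsilon> n)\<close>, but their signs locate the limit \<open>l\<close>.\<close>
  define u where "u = ?u n"
  \<comment> \<open>The orbits cover \<open>M\<close>, so \<open>q (\<epsilon> n)\<close> lies in
    some \<open>P i\<close> or \<open>N i\<close>; as these are disjoint, the weight there is
    nonzero.\<close>
  have "\<exists>i\<in>{1..m}. u i \<noteq> 0"
  proof -
    have "q (\<epsilon> n) \<in> (\<Union>i\<in>{1..m}. G_orbit (A i))"
      using q(1) unfolding assms(7) M_def .
    then obtain i where i: "i \<in> {1..m}" "q (\<epsilon> n) \<in> P i \<union> N i"
      by (auto simp: G_orbit_def P_def N_def)
    then have ne: "P i \<noteq> {}" "N i \<noteq> {}" by (auto simp: P_def N_def)
    from i(2) have "0 < bump (\<epsilon> n) (P i) (N i) (q (\<epsilon> n)) \<or> 0 < bump (\<epsilon> n) (N i) (P i) (q (\<epsilon> n))"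
      using bump_pos [OF \<epsilon>_pos closed(2) [OF i(1)] ne(2)] bump_pos [OF \<epsilon>_pos closed(1) [OF i(1)] ne(1)] disj [OF i(1)]
      by blast
    then have "u i \<noteq> 0"
      by (auto simp: u_def bump_swap [of _ "N i" "P i"])
    with i(1) show ?thesis ..
  qed
  define S where "S = {i \<in> {1..m}. u i < 0}"
  define T where "T = {i \<in> {1..m}. 0 < u i}"
  have hulls: "(seq_convex hull (x ` S)) \<inter> (seq_convex hull (x ` T)) \<noteq> {}"
    using q(2,3) \<open>\<exists>i\<in>{1..m}. u i \<noteq> 0\<close> unfolding S_def T_def
    by (intro seq_convex_hulls_meet) (auto simp: u_def)
  \<comment> \<open>A negative weight puts \<open>l\<close> in \<open>N i\<close> and a positive one
    in \<open>P i\<close>; each is a union of two translates, and the choice names one containing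
    \<open>l\<close>.\<close>
  define \<alpha> where "\<alpha> = (\<lambda>i. if l \<in> act g1 ` A i then g1 else g2)"
  define \<beta> where "\<beta> = (\<lambda>i. if l \<in> A i then 0 else g1 + g2)"
  have "l \<in> act (\<alpha> i) ` A i" if "i \<in> S" for i
    using that n by (auto simp: S_def \<alpha>_def u_def N_def)
  moreover have "l \<in> act (\<beta> i) ` A i" if "i \<in> T" for i
    using that n by (auto simp: T_def \<beta>_def u_def P_def act_zero)
  ultimately have meet: "(\<Inter>i\<in>S. act (\<alpha> i) ` A i) \<inter> (\<Inter>i\<in>T. act (\<beta> i) ` A i) \<noteq> {}"
    by blast
  have funs: "\<alpha> \<in> S \<rightarrow> {g1, g2}" "\<beta> \<in> T \<rightarrow> {0, g1 + g2}"
    by (simp_all add: \<alpha>_def \<beta>_def)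
  have "S \<subseteq> {1..m}" "T \<subseteq> {1..m}" "S \<inter> T = {}"
    by (auto simp: S_def T_def)
  with hulls meet funs show ?thesis
    by blast
qed

end
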